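(* Let $G$ be a group, let $\rho:G\to\mathcal{U}(\mathcal{H}_1)$ be a unitary representation on $\mathcal{H}_1=\mathbb{C}^3$ (the physical space), and let $\pi:G\to\mathcal{U}(\mathcal{H}_{1/2})$ be a (possibly projective) unitary representation on $\mathcal{H}_{1/2}=\mathbb{C}^2$ (the virtual space). Assume that the AKLT matrices satisfy the covariance condition $$\sum_{k'\in\{+,0,-\}}\rho(g)_{k'k}\,A_{k'}=\pi(g)A_k\pi(g)^\dagger\qquad\text{for all } g\in G,\ k\in\{+,0,-\},$$ where $\rho(g)_{k'k}=\langle k'|\rho(g)|k\rangle$. Let $\mathcal{E}_{O,H}:\mathcal{B}(\mathcal{H}_{1/2})\otimes\mathcal{B}(\mathcal{H}_1)\to\mathcal{B}(\mathcal{H}_{1/2})$ be the linear map $$\mathcal{E}_{O,H}(X\otimes Y)=\sum_{k,k'\in\{+,0,-\}}\langle k|Y|k'\rangle\,A_kXA_{k'}^\dagger .$$ Then $\mathcal{E}_{O,H}$ is $G$-equivariant: for all $g\in G$, $X\in\mathcal{B}(\mathcal{H}_{1/2})$ and $Y\in\mathcal{B}(\mathcal{H}_1)$, $$\mathcal{E}_{O,H}\big(\pi(g)X\pi(g)^\dagger\otimes\rho(g)Y\rho(g)^\dagger\big)=\pi(g)\,\mathcal{E}_{O,H}(X\otimes Y)\,\pi(g)^\dagger .$$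
   Context: $\mathcal{H}_1=\mathbb{C}^3$ has orthonormal basis $|+\rangle,|0\rangle,|-\rangle$; $\mathcal{U}(\mathcal{H})$ denotes the unitary group and $\mathcal{B}(\mathcal{H})$ the linear operators on $\mathcal{H}$. A projective unitary representation is a map $\pi:G\to\mathcal{U}(\mathcal{H}_{1/2})$ with $\pi(g_1)\pi(g_2)=\omega(g_1,g_2)\pi(g_1g_2)$ for some $\omega:G\times G\to \mathrm{U}(1)$. AKLT matrices: $A_+=\sqrt{2/3}\,\sigma^+$, $A_0=\sqrt{1/3}\,\sigma^z$, $A_-=-\sqrt{2/3}\,\sigma^-$, where $\sigma^+=\begin{pmatrix}0&1\\0&0\end{pmatrix}$, $\sigma^-=\begin{pmatrix}0&0\\1&0\end{pmatrix}$, $\sigma^z=\begin{pmatrix}1&0\\0&-1\end{pmatrix}$. *)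

theory Defs
  imports "HOL-Analysis.Analysis" "HOL-Algebra.Group"
begin

datatype spin1 = SPlus | SZero | SMinus

lemma UNIV_spin1: "UNIV = {SPlus, SZero, SMinus}"
  using spin1.exhaust by auto

instance spin1 :: finite
  by standard (simp add: UNIV_spin1)

text \<open>
  The virtual space is \<open>complex ^ 2\<close> and the physical space is \<open>complex ^ spin1\<close>, whose
  standard basis vectors are the kets labelled by \<open>spin1\<close>. Linear operators are identified with
  their matrices, so that \<open>Y $ k $ k'\<close> is the matrix element of \<open>Y\<close> between the bra labelled by
  \<open>k\<close> and the ket labelled by \<open>k'\<close>.
\<close>

definition cscale :: "complex \<Rightarrow> complex ^ 'n ^ 'm \<Rightarrow> complex ^ 'n ^ 'm"  (infixr \<open>*\<^sub>M\<close> 75)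
  where "c *\<^sub>M A = (\<chi> i j. c * A $ i $ j)"

definition dagger :: "complex ^ 'n ^ 'm \<Rightarrow> complex ^ 'm ^ 'n"  (\<open>_\<^sup>\<dagger>\<close> [1000] 999)
  where "A\<^sup>\<dagger> = (\<chi> i j. cnj (A $ j $ i))"

definition unitary_group :: "(complex ^ 'n ^ 'n) monoid"
  where "unitary_group =
    \<lparr>carrier = {U. U\<^sup>\<dagger> ** U = mat 1 \<and> U ** U\<^sup>\<dagger> = mat 1}, mult = (**), one = mat 1\<rparr>"

definition unitary_rep :: "('g, 'b) monoid_scheme \<Rightarrow> ('g \<Rightarrow> complex ^ 'n ^ 'n) \<Rightarrow> bool"
  where "unitary_rep G \<rho> \<longleftrightarrow> \<rho> \<in> hom G unitary_group"

text \<open>An ordinary unitary representation is the special case of constant multiplier 1.\<close>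

definition projective_unitary_rep :: "('g, 'b) monoid_scheme \<Rightarrow> ('g \<Rightarrow> complex ^ 'n ^ 'n) \<Rightarrow> bool"
  where "projective_unitary_rep G \<pi> \<longleftrightarrow>
    \<pi> \<in> carrier G \<rightarrow> carrier unitary_group \<and>
    (\<exists>\<omega>. (\<forall>g\<in>carrier G. \<forall>h\<in>carrier G. cmod (\<omega> g h) = 1 \<and>
        \<pi> g ** \<pi> h = \<omega> g h *\<^sub>M \<pi> (g \<otimes>\<^bsub>G\<^esub> h)))"

text \<open>
  The tensor product of two operator spaces is realised as the space of operators on the tensor
  product Hilbert space, with the Kronecker product as the elementary tensor; in finite dimension
  this loses nothing, as the elementary tensors span (see \<open>kron_expand\<close>).
\<close>

definition kron ::
    "complex ^ 'n ^ 'n \<Rightarrow> complex ^ 'm ^ 'm \<Rightarrow> complex ^ ('n \<times> 'm) ^ ('n \<times> 'm)"  (infixr \<open>\<otimes>\<^sub>M\<close> 70)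
  where "X \<otimes>\<^sub>M Y = (\<chi> p q. X $ fst p $ fst q * Y $ snd p $ snd q)"

definition sigma_plus :: "complex ^ 2 ^ 2"
  where "sigma_plus = vector [vector [0, 1], vector [0, 0]]"

definition sigma_minus :: "complex ^ 2 ^ 2"
  where "sigma_minus = vector [vector [0, 0], vector [1, 0]]"

definition sigma_z :: "complex ^ 2 ^ 2"
  where "sigma_z = vector [vector [1, 0], vector [0, -1]]"

primrec aklt :: "spin1 \<Rightarrow> complex ^ 2 ^ 2" where
  "aklt SPlus = complex_of_real (sqrt (2/3)) *\<^sub>M sigma_plus"
| "aklt SZero = complex_of_real (sqrt (1/3)) *\<^sub>M sigma_z"
| "aklt SMinus = (- complex_of_real (sqrt (2/3))) *\<^sub>M sigma_minus"

text \<open>The linear map given by a formula on elementary tensors; well defined by \<open>E_OH_ex1\<close>.\<close>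

definition E_OH :: "complex ^ (2 \<times> spin1) ^ (2 \<times> spin1) \<Rightarrow> complex ^ 2 ^ 2"
  where "E_OH = (THE E. Vector_Spaces.linear (*\<^sub>M) (*\<^sub>M) E \<and>
    (\<forall>X Y. E (X \<otimes>\<^sub>M Y) =
      (\<Sum>k\<in>UNIV. \<Sum>k'\<in>UNIV. (Y $ k $ k') *\<^sub>M (aklt k ** X ** (aklt k')\<^sup>\<dagger>))))"

lemma vector_space_cscale: "vector_space ((*\<^sub>M) :: complex \<Rightarrow> complex ^ 'n ^ 'm \<Rightarrow> _)"
  by unfold_locales (simp_all add: cscale_def vec_eq_iff algebra_simps)

lemma group_unitary_group: "group (unitary_group :: (complex ^ 'n ^ 'n) monoid)"
proof (rule groupI)
  have dm: "(A ** B)\<^sup>\<dagger> = B\<^sup>\<dagger> ** A\<^sup>\<dagger>" for A B :: "complex ^ 'n ^ 'n"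
    by (simp add: dagger_def matrix_matrix_mult_def vec_eq_iff mult.commute)
  have dd: "(A\<^sup>\<dagger>)\<^sup>\<dagger> = A" for A :: "complex ^ 'n ^ 'n"
    by (simp add: dagger_def vec_eq_iff)
  have d1: "(mat 1)\<^sup>\<dagger> = (mat 1 :: complex ^ 'n ^ 'n)"
    by (auto simp: dagger_def mat_def vec_eq_iff)
  let ?U = "unitary_group :: (complex ^ 'n ^ 'n) monoid"
  show "x \<otimes>\<^bsub>?U\<^esub> y \<in> carrier ?U" if "x \<in> carrier ?U" "y \<in> carrier ?U" for x y
  proof -
    have "y\<^sup>\<dagger> ** x\<^sup>\<dagger> ** (x ** y) = y\<^sup>\<dagger> ** (x\<^sup>\<dagger> ** x) ** y"
      "x ** y ** (y\<^sup>\<dagger> ** x\<^sup>\<dagger>) = x ** (y ** y\<^sup>\<dagger>) ** x\<^sup>\<dagger>"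
      by (simp_all only: matrix_mul_assoc)
    with that show ?thesis
      by (simp add: unitary_group_def dm)
  qed
  show "\<one>\<^bsub>?U\<^esub> \<in> carrier ?U"
    by (simp add: unitary_group_def d1)
  show "x \<otimes>\<^bsub>?U\<^esub> y \<otimes>\<^bsub>?U\<^esub> z = x \<otimes>\<^bsub>?U\<^esub> (y \<otimes>\<^bsub>?U\<^esub> z)" for x y z
    by (simp add: unitary_group_def matrix_mul_assoc)
  show "\<one>\<^bsub>?U\<^esub> \<otimes>\<^bsub>?U\<^esub> x = x" for x
    by (simp add: unitary_group_def)
  show "\<exists>y\<in>carrier ?U. y \<otimes>\<^bsub>?U\<^esub> x = \<one>\<^bsub>?U\<^esub>" if "x \<in> carrier ?U" for x
    using that by (auto simp: unitary_group_def dd intro!: exI[of _ "x\<^sup>\<dagger>"])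
qed

definition mat_unit :: "'n \<Rightarrow> 'n \<Rightarrow> complex ^ 'n ^ 'n"
  where "mat_unit a b = (\<chi> i j. if i = a \<and> j = b then 1 else 0)"

lemma kron_expand:
  fixes Z :: "complex ^ ('n::finite \<times> 'm::finite) ^ ('n \<times> 'm)"
  shows "Z = (\<Sum>p\<in>UNIV. \<Sum>q\<in>UNIV.
    (Z $ p $ q) *\<^sub>M (mat_unit (fst p) (fst q) \<otimes>\<^sub>M mat_unit (snd p) (snd q)))"
proof -
  have "mat_unit (fst p) (fst q) \<otimes>\<^sub>M mat_unit (snd p) (snd q) = mat_unit p q"
    for p q :: "'n \<times> 'm"
    by (auto simp: kron_def mat_unit_def vec_eq_iff prod_eq_iff)
  moreover have "(\<Sum>p\<in>UNIV. \<Sum>q\<in>UNIV. Z $ p $ q * (if i = p \<and> j = q then 1 else 0)) = Z $ i $ j"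
    for i j
  proof -
    have "(\<Sum>q\<in>UNIV. Z $ p $ q * (if i = p \<and> j = q then 1 else 0)) =
        (if i = p then Z $ p $ j else 0)" for p
      by (cases "i = p") (simp_all add: if_distrib cong: if_cong)
    then show ?thesis by simp
  qed
  ultimately show ?thesis
    by (simp add: cscale_def mat_unit_def vec_eq_iff sum_component)
qed

lemma E_OH_ex1:
  "\<exists>!E. Vector_Spaces.linear (*\<^sub>M) (*\<^sub>M) E \<and>
    (\<forall>(X :: complex ^ 2 ^ 2) Y. E (X \<otimes>\<^sub>M Y) =
      (\<Sum>k\<in>UNIV. \<Sum>k'\<in>UNIV. (Y $ k $ k') *\<^sub>M (aklt k ** X ** (aklt k')\<^sup>\<dagger>)))"
  (is "\<exists>!E. ?P E")
proof (rule ex1I)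
  define F :: "complex ^ (2 \<times> spin1) ^ (2 \<times> spin1) \<Rightarrow> complex ^ 2 ^ 2" where
    "F Z = (\<Sum>k\<in>UNIV. \<Sum>k'\<in>UNIV. aklt k ** (\<chi> i j. Z $ (i, k) $ (j, k')) ** (aklt k')\<^sup>\<dagger>)" for Z
  have lin: "Vector_Spaces.linear (*\<^sub>M) (*\<^sub>M) F"
  proof (intro Vector_Spaces.linear.intro vector_space_cscale module_hom.intro module_hom_axioms.intro)
    fix Z W :: "complex ^ (2 \<times> spin1) ^ (2 \<times> spin1)"
    have split: "(\<chi> i j. (Z + W) $ (i, k) $ (j, k')) =
        (\<chi> i j. Z $ (i, k) $ (j, k')) + (\<chi> i j. W $ (i, k) $ (j, k'))" for k k'
      by (simp add: vec_eq_iff)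
    show "F (Z + W) = F Z + F W"
      unfolding F_def split
      by (simp add: matrix_matrix_mult_def vec_eq_iff sum_component sum.distrib algebra_simps)
  next
    fix c and Z :: "complex ^ (2 \<times> spin1) ^ (2 \<times> spin1)"
    have "(\<chi> i j. (c *\<^sub>M Z) $ (i, k) $ (j, k')) = c *\<^sub>M (\<chi> i j. Z $ (i, k) $ (j, k'))" for k k'
      by (simp add: vec_eq_iff cscale_def)
    then show "F (c *\<^sub>M Z) = c *\<^sub>M F Z"
      by (simp add: F_def cscale_def matrix_matrix_mult_def vec_eq_iff sum_component
          sum_distrib_left sum_distrib_right mult_ac)
  qed (use vector_space_cscale in \<open>auto simp: module_iff_vector_space\<close>)
  moreover have "F (X \<otimes>\<^sub>M Y) =
      (\<Sum>k\<in>UNIV. \<Sum>k'\<in>UNIV. (Y $ k $ k') *\<^sub>M (aklt k ** X ** (aklt k')\<^sup>\<dagger>))" for X Y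
    by (simp add: F_def kron_def cscale_def matrix_matrix_mult_def vec_eq_iff sum_component
        sum_distrib_left sum_distrib_right mult_ac)
  ultimately show PF: "?P F" by blast
  fix E assume E: "?P E"
  interpret E: Vector_Spaces.linear "(*\<^sub>M)" "(*\<^sub>M)" E using E by blast
  interpret F: Vector_Spaces.linear "(*\<^sub>M)" "(*\<^sub>M)" F using lin .
  have eq: "E (X \<otimes>\<^sub>M Y) = F (X \<otimes>\<^sub>M Y)" for X Y
    using E PF by simp
  show "E = F"
  proof
    fix Z :: "complex ^ (2 \<times> spin1) ^ (2 \<times> spin1)"
    show "E Z = F Z"
      by (subst (1 2) kron_expand) (simp only: E.sum E.scale F.sum F.scale eq)
  qed
qed

lemma E_OH_linear: "Vector_Spaces.linear (*\<^sub>M) (*\<^sub>M) E_OH"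
  and E_OH_kron: "E_OH (X \<otimes>\<^sub>M Y) =
    (\<Sum>k\<in>UNIV. \<Sum>k'\<in>UNIV. (Y $ k $ k') *\<^sub>M (aklt k ** X ** (aklt k')\<^sup>\<dagger>))"
  using theI'[OF E_OH_ex1, folded E_OH_def] by blast+

end

theory Submission
  imports Defs
begin

text \<open>Conjugating the physical operator by \<rho>(g) can be traded for a change of the
  Kraus-type matrices: each A_l becomes the combination of the A_k with coefficients from column l
  of \<rho>(g), on both sides of X (\<open>kraus_sum_conj\<close>). Covariance identifies this
  combination with \<pi>(g) A_l \<pi>(g)^*. In each summand the inner factors \<pi>(g)^* \<pi>(g)
  next to X then cancel by unitarity, and the outer \<pi>(g) and \<pi>(g)^* come out of the sum by
  linearity.\<close>

lemma dagger_mult: "(A ** B)\<^sup>\<dagger> = B\<^sup>\<dagger> ** A\<^sup>\<dagger>"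
  by (simp add: dagger_def matrix_matrix_mult_def vec_eq_iff mult.commute)

lemma dagger_dagger: "(A\<^sup>\<dagger>)\<^sup>\<dagger> = A"
  by (simp add: dagger_def vec_eq_iff)

lemma dagger_cscale: "(c *\<^sub>M A)\<^sup>\<dagger> = cnj c *\<^sub>M A\<^sup>\<dagger>"
  by (simp add: dagger_def cscale_def vec_eq_iff)

lemma dagger_sum: "(\<Sum>i\<in>I. f i)\<^sup>\<dagger> = (\<Sum>i\<in>I. (f i)\<^sup>\<dagger>)"
  by (simp add: dagger_def vec_eq_iff sum_component)

lemma cscale_cscale: "c *\<^sub>M d *\<^sub>M A = (c * d) *\<^sub>M A"
  by (simp add: cscale_def vec_eq_iff mult.assoc)

lemma cscale_sum_left: "(\<Sum>i\<in>I. c i) *\<^sub>M A = (\<Sum>i\<in>I. c i *\<^sub>M A)"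
  by (simp add: cscale_def vec_eq_iff sum_component sum_distrib_right)

lemma cscale_sum_right: "c *\<^sub>M (\<Sum>i\<in>I. f i) = (\<Sum>i\<in>I. c *\<^sub>M f i)"
  by (simp add: cscale_def vec_eq_iff sum_component sum_distrib_left)

lemma cscale_matrix_mult: "(c *\<^sub>M A) ** B = c *\<^sub>M (A ** B)"
  by (simp add: cscale_def matrix_matrix_mult_def vec_eq_iff sum_distrib_left mult_ac)

lemma matrix_mult_cscale: "A ** (c *\<^sub>M B) = c *\<^sub>M (A ** B)"
  by (simp add: cscale_def matrix_matrix_mult_def vec_eq_iff sum_distrib_left mult_ac)

lemma sum_matrix_mult:
  fixes B :: "'a::semiring_1 ^ 'n ^ 'm"
  shows "(\<Sum>i\<in>I. f i) ** B = (\<Sum>i\<in>I. f i ** B)"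
  \<comment> \<open>Fixing one index set as \<open>I\<close> makes the exchange of sums usable as a
    one-way rewrite rule.\<close>
  by (simp add: matrix_matrix_mult_def vec_eq_iff sum_component sum_distrib_right sum.swap[of _ I])

lemma matrix_mult_sum:
  fixes A :: "'a::semiring_1 ^ 'n ^ 'm"
  shows "A ** (\<Sum>i\<in>I. f i) = (\<Sum>i\<in>I. A ** f i)"
  by (simp add: matrix_matrix_mult_def vec_eq_iff sum_component sum_distrib_left sum.swap[of _ I])

text \<open>The expression is linear in the left matrix and conjugate-linear in the right one, so
  the entries of \<open>R\<close> can be absorbed into the \<open>A k\<close> on the left and,
  conjugated, into the \<open>A k'\<close> on the right. This holds for any \<open>R\<close> and any
  family \<open>A\<close>.\<close>

lemma kraus_sum_conj:
  fixes R Y :: "complex ^ 's ^ 's" and A :: "'s::finite \<Rightarrow> complex ^ 'n ^ 'm"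
  shows "(\<Sum>k\<in>UNIV. \<Sum>k'\<in>UNIV. ((R ** Y ** R\<^sup>\<dagger>) $ k $ k') *\<^sub>M (A k ** X ** (A k')\<^sup>\<dagger>)) =
    (\<Sum>l\<in>UNIV. \<Sum>l'\<in>UNIV. (Y $ l $ l') *\<^sub>M
      ((\<Sum>k\<in>UNIV. (R $ k $ l) *\<^sub>M A k) ** X ** (\<Sum>k'\<in>UNIV. (R $ k' $ l') *\<^sub>M A k')\<^sup>\<dagger>))"
    (is "?L = ?R")
proof -
  \<comment> \<open>Both sides are the sum of this term over all four indices; only the order of
    summation differs.\<close>
  define T where "T k k' l l' = (R $ k $ l * Y $ l $ l' * cnj (R $ k' $ l')) *\<^sub>M
    (A k ** X ** (A k')\<^sup>\<dagger>)" for k k' l l'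
  have entry: "(R ** Y ** R\<^sup>\<dagger>) $ k $ k' =
      (\<Sum>l'\<in>UNIV. \<Sum>l\<in>UNIV. R $ k $ l * Y $ l $ l' * cnj (R $ k' $ l'))" for k k'
    by (simp add: matrix_matrix_mult_def dagger_def sum_distrib_right)
  have "?L = (\<Sum>k\<in>UNIV. \<Sum>k'\<in>UNIV. \<Sum>l'\<in>UNIV. \<Sum>l\<in>UNIV. T k k' l l')"
    unfolding T_def entry by (simp only: cscale_sum_left)
  also have "\<dots> = (\<Sum>l'\<in>UNIV. \<Sum>l\<in>UNIV. \<Sum>k\<in>UNIV. \<Sum>k'\<in>UNIV. T k k' l l')"
    \<comment> \<open>Adjacent transpositions: \<open>l'\<close> moves outward past
      \<open>k'\<close> and \<open>k\<close>, then \<open>l\<close> does the same.\<close>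
    by (subst (2) sum.swap, subst (1) sum.swap, subst (3) sum.swap, subst (2) sum.swap) (rule refl)
  \<comment> \<open>This is the order in which distributing the products in \<open>?R\<close> leaves
    the sums.\<close>
  also have "\<dots> = (\<Sum>l\<in>UNIV. \<Sum>l'\<in>UNIV. \<Sum>k'\<in>UNIV. \<Sum>k\<in>UNIV. T k k' l l')"
    by (subst sum.swap, subst (3) sum.swap) (rule refl)
  also have "\<dots> = ?R"
    unfolding T_def
    by (simp add: dagger_sum dagger_cscale sum_matrix_mult matrix_mult_sum cscale_matrix_mult
        matrix_mult_cscale cscale_sum_right cscale_cscale mult_ac)
  finally show ?thesis .
qed

theorem theorem5p1:
  fixes G :: "('g, 'b) monoid_scheme"
    and \<rho> :: "'g \<Rightarrow> complex ^ spin1 ^ spin1"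
    and \<pi> :: "'g \<Rightarrow> complex ^ 2 ^ 2"
  assumes "group G"
    and "unitary_rep G \<rho>"
    and "projective_unitary_rep G \<pi>"
    and "\<And>g k. g \<in> carrier G \<Longrightarrow>
      (\<Sum>k'\<in>UNIV. (\<rho> g $ k' $ k) *\<^sub>M aklt k') = \<pi> g ** aklt k ** (\<pi> g)\<^sup>\<dagger>"
  shows "\<forall>g\<in>carrier G. \<forall>X Y.
    E_OH ((\<pi> g ** X ** (\<pi> g)\<^sup>\<dagger>) \<otimes>\<^sub>M (\<rho> g ** Y ** (\<rho> g)\<^sup>\<dagger>)) =
      \<pi> g ** E_OH (X \<otimes>\<^sub>M Y) ** (\<pi> g)\<^sup>\<dagger>"
proof (intro ballI allI)
  fix g X Y
  assume g: "g \<in> carrier G"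
  have "\<pi> g \<in> carrier unitary_group"
    using assms(3) g by (auto simp: projective_unitary_rep_def)
  then have "(\<pi> g)\<^sup>\<dagger> ** \<pi> g = mat 1"
    by (simp add: unitary_group_def)
  \<comment> \<open>The prefix \<open>B\<close> is there because \<open>matrix_mul_assoc\<close>
    brackets products to the left, so the pair to be cancelled is not a subterm by itself.\<close>
  then have cancel: "B ** (\<pi> g)\<^sup>\<dagger> ** \<pi> g = B" for B :: "complex ^ 2 ^ 2"
    by (simp flip: matrix_mul_assoc)
  have "E_OH ((\<pi> g ** X ** (\<pi> g)\<^sup>\<dagger>) \<otimes>\<^sub>M (\<rho> g ** Y ** (\<rho> g)\<^sup>\<dagger>)) =
    (\<Sum>l\<in>UNIV. \<Sum>l'\<in>UNIV. (Y $ l $ l') *\<^sub>M ((\<pi> g ** aklt l ** (\<pi> g)\<^sup>\<dagger>) **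
      (\<pi> g ** X ** (\<pi> g)\<^sup>\<dagger>) ** (\<pi> g ** aklt l' ** (\<pi> g)\<^sup>\<dagger>)\<^sup>\<dagger>))"
    by (simp only: E_OH_kron kraus_sum_conj assms(4)[OF g])
  \<comment> \<open>The adjoint of the right factor is again a conjugate by \<open>\<pi> g\<close>,
    so \<open>cancel\<close> applies once on each side of \<open>X\<close>.\<close>
  also have "\<dots> = \<pi> g ** E_OH (X \<otimes>\<^sub>M Y) ** (\<pi> g)\<^sup>\<dagger>"
    by (simp add: E_OH_kron dagger_mult dagger_dagger sum_matrix_mult matrix_mult_sum
        cscale_matrix_mult matrix_mult_cscale matrix_mul_assoc cancel)
  finally show "E_OH ((\<pi> g ** X ** (\<pi> g)\<^sup>\<dagger>) \<otimes>\<^sub>M (\<rho> g ** Y ** (\<rho> g)\<^sup>\<dagger>)) =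
    \<pi> g ** E_OH (X \<otimes>\<^sub>M Y) ** (\<pi> g)\<^sup>\<dagger>" .
qed

end
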